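(* Let $\gamma>0$, let $\Omega\subset\mathbb{R}^N$ be a bounded smooth domain, and let $f:[0,\infty)\to\mathbb{R}$ be locally Lipschitz continuous and non-decreasing, with $f(s)>0$ for $s>0$ and $f(0)\ge 0$. Let $u\in C(\overline{\Omega})\cap C^2(\Omega)$ be a solution to $$-\Delta u=\frac{1}{u^\gamma}+f(u)\ \text{ in }\Omega,\qquad u>0\ \text{ in }\Omega,\qquad u=0\ \text{ on }\partial\Omega ,$$ and let $w=u-u_0$. Then there exists a constant $\delta=\delta(u,f)>0$, depending only on $u$ and $f$, with the following property: if $\nu\in\mathbb{R}^N$ with $|\nu|=1$, $a(\nu)<\lambda<\lambda_1(\nu)$, $\Omega'\subseteq\Omega_\lambda^\nu$ is open with $$w\le w_\lambda^\nu\quad\text{on }\partial\Omega',$$ and $\mathcal{L}(\Omega')\le\delta$, then $$w\le w_\lambda^\nu\quad\text{in }\Omega'.$$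
   Context: $u_0\in C(\overline\Omega)\cap C^2(\Omega)$ denotes the unique solution of $-\Delta u_0=u_0^{-\gamma}$ in $\Omega$, $u_0>0$ in $\Omega$, $u_0=0$ on $\partial\Omega$. It is known that $w=u-u_0\in H^1_0(\Omega)$, i.e. $u=u_0+w$ with $w\in H_0^1(\Omega)$. Notation: $\mathcal{L}$ is the Lebesgue measure; $\Omega_\lambda^\nu=\{x\in\Omega: x\cdot\nu<\lambda\}$; $x_\lambda^\nu=R_\lambda^\nu(x)=x+2(\lambda-x\cdot\nu)\nu$ is the reflection through the hyperplane $\{x\cdot\nu=\lambda\}$; $(\Omega_\lambda^\nu)'=R_\lambda^\nu(\Omega_\lambda^\nu)$; $a(\nu)=\inf_{x\in\Omega}x\cdot\nu$; $\lambda_1(\nu)=\sup\{\lambda>a(\nu): (\Omega_t^\nu)'\subset\Omega\text{ for all } a(\nu)<t\le\lambda\}$; $w_\lambda^\nu(x)=w(x_\lambda^\nu)$. *)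

theory Defs
  imports "HOL-Analysis.Analysis"
begin

definition partial_deriv :: "'a::euclidean_space \<Rightarrow> ('a \<Rightarrow> real) \<Rightarrow> 'a \<Rightarrow> real" where
  "partial_deriv b g x = frechet_derivative g (at x) b"

text \<open>The class \<open>C\<^sup>k(S)\<close>, intended for open \<open>S\<close>: derivatives are taken at points of \<open>S\<close>, so only
  the values of the total function \<open>g\<close> on \<open>S\<close> matter.\<close>

fun Ck_on :: "nat \<Rightarrow> 'a::euclidean_space set \<Rightarrow> ('a \<Rightarrow> real) \<Rightarrow> bool" where
  "Ck_on 0 S g \<longleftrightarrow> continuous_on S g"
| "Ck_on (Suc k) S g \<longleftrightarrow>
     (\<forall>x\<in>S. g differentiable (at x)) \<and> (\<forall>b\<in>Basis. Ck_on k S (partial_deriv b g))"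

definition laplacian :: "('a::euclidean_space \<Rightarrow> real) \<Rightarrow> 'a \<Rightarrow> real" where
  "laplacian g x = (\<Sum>b\<in>Basis. partial_deriv b (partial_deriv b g) x)"

text \<open>Near each boundary point the domain is the part of a ball lying above the graph of a
  smooth function over the hyperplane orthogonal to some unit vector \<open>e\<close>.  A smooth function
  on that hyperplane is represented by a smooth function on the whole space, evaluated at the
  orthogonal projection \<open>x - (x \<bullet> e) *\<^sub>R e\<close>.\<close>

definition smooth_boundary :: "'a::euclidean_space set \<Rightarrow> bool" where
  "smooth_boundary \<Omega> \<longleftrightarrow>
     (\<forall>p\<in>frontier \<Omega>. \<exists>r>0. \<exists>e g. norm e = 1 \<and> (\<forall>k. Ck_on k UNIV g) \<and>
        \<Omega> \<inter> ball p r = {x \<in> ball p r. x \<bullet> e > g (x - (x \<bullet> e) *\<^sub>R e)})"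

definition bounded_smooth_domain :: "'a::euclidean_space set \<Rightarrow> bool" where
  "bounded_smooth_domain \<Omega> \<longleftrightarrow>
     \<Omega> \<noteq> {} \<and> open \<Omega> \<and> connected \<Omega> \<and> bounded \<Omega> \<and> smooth_boundary \<Omega>"

text \<open>The library's \<open>local_lipschitz\<close> is stated for families of functions indexed by a
  parameter; here the family is constant.\<close>

abbreviation locally_lipschitz_on :: "real set \<Rightarrow> (real \<Rightarrow> real) \<Rightarrow> bool" where
  "locally_lipschitz_on X f \<equiv> local_lipschitz (UNIV :: real set) X (\<lambda>_. f)"

text \<open>Classical solutions of \<open>-\<Delta>u = u\<^sup>-\<^sup>\<gamma> + f(u)\<close> in \<open>\<Omega>\<close>, positive in \<open>\<Omega>\<close> and vanishing on the
  boundary.  The function \<open>u\<^sub>0\<close> is the solution for \<open>f = 0\<close>.\<close>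

definition singular_solution ::
    "real \<Rightarrow> (real \<Rightarrow> real) \<Rightarrow> 'a::euclidean_space set \<Rightarrow> ('a \<Rightarrow> real) \<Rightarrow> bool" where
  "singular_solution \<gamma> f \<Omega> u \<longleftrightarrow>
     continuous_on (closure \<Omega>) u \<and> Ck_on 2 \<Omega> u \<and>
     (\<forall>x\<in>\<Omega>. - laplacian u x = 1 / (u x powr \<gamma>) + f (u x)) \<and>
     (\<forall>x\<in>\<Omega>. u x > 0) \<and>
     (\<forall>x\<in>frontier \<Omega>. u x = 0)"

definition cap :: "'a::euclidean_space set \<Rightarrow> 'a \<Rightarrow> real \<Rightarrow> 'a set" where
  "cap \<Omega> \<nu> t = {x \<in> \<Omega>. x \<bullet> \<nu> < t}"

definition reflection :: "'a::euclidean_space \<Rightarrow> real \<Rightarrow> 'a \<Rightarrow> 'a" where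
  "reflection \<nu> t x = x + (2 * (t - x \<bullet> \<nu>)) *\<^sub>R \<nu>"

definition a_dir :: "'a::euclidean_space set \<Rightarrow> 'a \<Rightarrow> real" where
  "a_dir \<Omega> \<nu> = (INF x\<in>\<Omega>. x \<bullet> \<nu>)"

text \<open>The supremum is taken in the extended reals, where it is meaningful without
  first knowing that the set is nonempty and bounded above.\<close>

definition lambda1 :: "'a::euclidean_space set \<Rightarrow> 'a \<Rightarrow> ereal" where
  "lambda1 \<Omega> \<nu> = Sup {ereal l | l. l > a_dir \<Omega> \<nu> \<and>
     (\<forall>t. a_dir \<Omega> \<nu> < t \<and> t \<le> l \<longrightarrow> reflection \<nu> t ` cap \<Omega> \<nu> t \<subseteq> \<Omega>)}"

end

theory Submission
  imports Defs
begin

text \<open>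
  Write \<open>w\<^sub>R x = w (reflection \<nu> l x)\<close>.  The difference \<open>\<phi> = w - w\<^sub>R\<close> is shown to satisfy
  \<open>-\<Delta>\<phi> \<le> L \<phi>\<close> wherever it is positive, with \<open>L\<close> depending only on \<open>u\<close> and \<open>f\<close>; a maximum principle
  for sets of small measure then forces \<open>\<phi> \<le> 0\<close>.

  For the differential inequality, the classical maximum principle gives \<open>u\<^sub>0 \<le> u\<close> in \<open>\<Omega>\<close>
  (\<open>singular_solution_comparison\<close>) and monotonicity of \<open>u\<^sub>0\<close> in the cap, \<open>u\<^sub>0 \<le> u\<^sub>0 \<circ> R\<close>
  (\<open>singular_solution_le_reflection\<close>), because the singular nonlinearity is decreasing.  So
  \<open>w \<ge> 0\<close>, and since \<open>(s + w) powr -\<gamma> - s powr -\<gamma>\<close> increases with \<open>s\<close> and decreases with \<open>w\<close>, the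
  singular terms contribute nothing positive to \<open>-\<Delta>\<phi>\<close> where \<open>w \<ge> w\<^sub>R\<close>.  The remaining term
  \<open>f (u x) - f (u (R x))\<close> is at most \<open>L (w - w\<^sub>R)\<close>, with \<open>L\<close> a Lipschitz constant of \<open>f\<close> on
  \<open>[0, 2 max u]\<close> (\<open>reflection_difference_inequality\<close>).

  The maximum principle (\<open>small_volume_maximum_principle\<close>) needs no Sobolev spaces.  If \<open>\<phi>\<close> has a
  maximum \<open>M > 0\<close> at \<open>x\<^sub>0\<close>, then \<open>V = (max 0 (\<phi> - M/8))\<^sup>3\<close>, extended by zero, is twice continuously
  differentiable on the whole space, vanishes outside the small set, and satisfies
  \<open>\<Delta>V \<ge> - 3 L M\<^sup>3\<close>.  A weighted sub-mean-value inequality on a ball of radius \<open>r\<close>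
  (\<open>weighted_mean_value\<close>) bounds \<open>V x\<^sub>0\<close>, which is more than half of \<open>M\<^sup>3\<close>, by \<open>M\<^sup>3\<close> times a multiple
  of the measure of the set divided by \<open>r\<close> to the power of the dimension, plus a multiple of
  \<open>L r\<^sup>2 M\<^sup>3\<close>.  This is impossible when first \<open>r\<close> and then the measure are small.\<close>

section \<open>Twice continuously differentiable functions and their Laplacian\<close>

text \<open>\<open>g\<close> is twice continuously differentiable on \<open>S\<close>, with gradient field \<open>G\<close> and Hessian \<open>H\<close>.  The
  Hessian at \<open>x\<close> is encoded as the linear map \<open>H x\<close> that is the derivative of \<open>G\<close>.  The derivatives
  are two-sided, so \<open>S\<close> is meant to be open.\<close>

definition C2_on :: "'a::euclidean_space set \<Rightarrow> ('a \<Rightarrow> real) \<Rightarrow> ('a \<Rightarrow> 'a) \<Rightarrow> ('a \<Rightarrow> 'a \<Rightarrow> 'a) \<Rightarrow> bool" where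
  "C2_on S g G H \<longleftrightarrow>
     (\<forall>x\<in>S. (g has_derivative (\<lambda>h. G x \<bullet> h)) (at x)) \<and>
     (\<forall>x\<in>S. (G has_derivative H x) (at x)) \<and>
     (\<forall>h. continuous_on S (\<lambda>x. H x h))"

text \<open>The trace in the standard basis; \<open>trace_of (H x)\<close> is the Laplacian.\<close>

definition trace_of :: "('a::euclidean_space \<Rightarrow> 'a) \<Rightarrow> real" where
  "trace_of T = (\<Sum>b\<in>Basis. T b \<bullet> b)"

lemma C2_on_continuous: "C2_on S g G H \<Longrightarrow> continuous_on S g"
  unfolding C2_on_def
  by (meson continuous_at_imp_continuous_on has_derivative_continuous)

lemma C2_on_continuous_gradient: "C2_on S g G H \<Longrightarrow> continuous_on S G"
  unfolding C2_on_def
  by (meson continuous_at_imp_continuous_on has_derivative_continuous)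

lemma C2_on_subset: "C2_on S g G H \<Longrightarrow> T \<subseteq> S \<Longrightarrow> C2_on T g G H"
  unfolding C2_on_def by (meson continuous_on_subset subsetD)

lemma C2_on_diff:
  assumes "C2_on S g G H" "C2_on S g' G' H'"
  shows "C2_on S (\<lambda>x. g x - g' x) (\<lambda>x. G x - G' x) (\<lambda>x h. H x h - H' x h)"
  unfolding C2_on_def inner_diff_left
proof (intro conjI ballI allI)
  show "((\<lambda>x. g x - g' x) has_derivative (\<lambda>h. G x \<bullet> h - G' x \<bullet> h)) (at x)" if "x \<in> S" for x
    by (rule has_derivative_diff) (use assms that in \<open>simp_all add: C2_on_def\<close>)
  show "((\<lambda>x. G x - G' x) has_derivative (\<lambda>h. H x h - H' x h)) (at x)" if "x \<in> S" for x
    by (rule has_derivative_diff) (use assms that in \<open>simp_all add: C2_on_def\<close>)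
  show "continuous_on S (\<lambda>x. H x h - H' x h)" for h
    by (rule continuous_on_diff) (use assms in \<open>simp_all add: C2_on_def\<close>)
qed

lemma trace_of_diff: "trace_of (\<lambda>h. S h - T h) = trace_of S - trace_of T"
  by (simp add: trace_of_def inner_diff_left sum_subtractf)

lemma trace_of_add_rank_one:
  "trace_of (\<lambda>h. a *\<^sub>R T h + (c * (v \<bullet> h)) *\<^sub>R v) = a * trace_of T + c * (v \<bullet> v)"
  by (simp only: trace_of_def inner_add_left inner_scaleR_left sum.distrib sum_distrib_left
      euclidean_inner[of v v] mult.assoc)

lemma C2_on_cong:
  assumes "C2_on S g G H" "open S" "\<And>x. x \<in> S \<Longrightarrow> g x = g' x" "\<And>x. x \<in> S \<Longrightarrow> G x = G' x"
    "\<And>x. x \<in> S \<Longrightarrow> H x = H' x"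
  shows "C2_on S g' G' H'"
  unfolding C2_on_def
proof (intro conjI ballI allI)
  fix x assume x: "x \<in> S"
  have "(g has_derivative (\<lambda>h. G' x \<bullet> h)) (at x)"
    using assms(1) x assms(4)[OF x, symmetric] by (simp add: C2_on_def)
  then show "(g' has_derivative (\<lambda>h. G' x \<bullet> h)) (at x)"
    by (rule has_derivative_transform_within_open[OF _ assms(2) x assms(3)])
  have "(G has_derivative H' x) (at x)"
    using assms(1) x assms(5)[OF x, symmetric] by (simp add: C2_on_def)
  then show "(G' has_derivative H' x) (at x)"
    by (rule has_derivative_transform_within_open[OF _ assms(2) x assms(4)])
next
  fix h show "continuous_on S (\<lambda>x. H' x h)"
    using assms(1) continuous_on_cong[OF refl, of S "\<lambda>x. H x h" "\<lambda>x. H' x h"] assms(5)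
    unfolding C2_on_def by metis
qed

lemma C2_on_Un:
  assumes "C2_on S g G H" "C2_on T g G H" "open S" "open T"
  shows "C2_on (S \<union> T) g G H"
  unfolding C2_on_def
proof (intro conjI allI)
  show "\<forall>x\<in>S \<union> T. (g has_derivative (\<lambda>h. G x \<bullet> h)) (at x)"
    using assms(1,2) unfolding C2_on_def by blast
  show "\<forall>x\<in>S \<union> T. (G has_derivative H x) (at x)"
    using assms(1,2) unfolding C2_on_def by blast
  show "continuous_on (S \<union> T) (\<lambda>x. H x h)" for h
    by (rule continuous_on_open_Un) (use assms in \<open>simp_all add: C2_on_def\<close>)
qed

lemma C2_on_of_Ck_on:
  assumes "Ck_on 2 S g" and S: "open S"
  shows "\<exists>G H. C2_on S g G H \<and> (\<forall>x\<in>S. trace_of (H x) = laplacian g x)"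
proof -
  have C: "Ck_on (Suc (Suc 0)) S g" using assms(1) by (simp add: numeral_2_eq_2)
  define G where "G x = (\<Sum>b\<in>Basis. partial_deriv b g x *\<^sub>R b)" for x
  define H where "H x h = (\<Sum>b\<in>Basis. (\<Sum>j\<in>Basis. partial_deriv j (partial_deriv b g) x * (j \<bullet> h)) *\<^sub>R b)" for x h
  have repr: "(k has_derivative (\<lambda>h. \<Sum>j\<in>Basis. partial_deriv j k x * (j \<bullet> h))) (at x)"
    if d: "k differentiable (at x)" for k :: "'a \<Rightarrow> real" and x
  proof -
    have fd: "(k has_derivative frechet_derivative k (at x)) (at x)"
      using d by (simp add: frechet_derivative_works)
    have lin: "linear (frechet_derivative k (at x))" using fd by (rule has_derivative_linear)
    have "frechet_derivative k (at x) h = (\<Sum>j\<in>Basis. partial_deriv j k x * (j \<bullet> h))" for h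
    proof -
      have "frechet_derivative k (at x) h = frechet_derivative k (at x) (\<Sum>j\<in>Basis. (h \<bullet> j) *\<^sub>R j)"
        by (simp add: euclidean_representation)
      also have "\<dots> = (\<Sum>j\<in>Basis. partial_deriv j k x * (j \<bullet> h))"
        by (simp add: linear_sum[OF lin] linear_cmul[OF lin] partial_deriv_def inner_commute mult.commute)
      finally show ?thesis .
    qed
    then show ?thesis using fd by (metis (no_types, lifting) ext)
  qed
  have "C2_on S g G H" unfolding C2_on_def
  proof (intro conjI ballI allI)
    fix x assume x: "x \<in> S"
    have "(g has_derivative (\<lambda>h. \<Sum>j\<in>Basis. partial_deriv j g x * (j \<bullet> h))) (at x)"
      using C x by (intro repr) simp
    then show "(g has_derivative (\<lambda>h. G x \<bullet> h)) (at x)"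
      by (simp add: G_def inner_sum_left)
    show "(G has_derivative H x) (at x)"
      unfolding G_def H_def
      by (intro has_derivative_sum has_derivative_scaleR_left repr) (use C x in simp)
  next
    fix h show "continuous_on S (\<lambda>x. H x h)"
      unfolding H_def by (intro continuous_intros) (use C in simp)
  qed
  moreover have "trace_of (H x) = laplacian g x" for x
    unfolding trace_of_def H_def laplacian_def
    by (simp add: inner_Basis if_distrib sum.delta cong: if_cong)
  ultimately show ?thesis by blast
qed

text \<open>Powers of the positive part with exponent at least two are differentiable, also at the origin.\<close>

lemma DERIV_max0_power:
  fixes t :: real
  shows "((\<lambda>t. (max 0 t) ^ Suc (Suc n)) has_real_derivative real (n + 2) * (max 0 t) ^ Suc n) (at t)"
proof (cases t "0::real" rule: linorder_cases)
  case less
  have "((\<lambda>t::real. 0) has_real_derivative 0) (at t)" by simp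
  then have "((\<lambda>t. (max 0 t) ^ Suc (Suc n)) has_real_derivative 0) (at t)"
    by (rule has_field_derivative_transform_within_open[where S="{..<0}"]) (use less in auto)
  then show ?thesis using less by simp
next
  case greater
  have "((\<lambda>t. t ^ Suc (Suc n)) has_real_derivative real (n + 2) * t ^ Suc n) (at t)"
    by (rule derivative_eq_intros refl)+ simp
  then have "((\<lambda>t. (max 0 t) ^ Suc (Suc n)) has_real_derivative real (n + 2) * t ^ Suc n) (at t)"
    by (rule has_field_derivative_transform_within_open[where S="{0<..}"]) (use greater in auto)
  then show ?thesis using greater by simp
next
  case equal
  have "((\<lambda>h::real. (max 0 h) ^ Suc n) \<longlongrightarrow> (max 0 0) ^ Suc n) (at 0)"
    by (intro tendsto_intros)
  then have "((\<lambda>h::real. (max 0 h) ^ Suc n) \<longlongrightarrow> 0) (at 0)" by simp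
  moreover have "\<forall>\<^sub>F h in at (0::real). (max 0 h) ^ Suc n = ((max 0 (0 + h)) ^ Suc (Suc n) - (max 0 0) ^ Suc (Suc n)) / h"
    by (auto simp: eventually_at_filter max_def)
  ultimately have "((\<lambda>h::real. ((max 0 (0 + h)) ^ Suc (Suc n) - (max 0 0) ^ Suc (Suc n)) / h) \<longlongrightarrow> 0) (at 0)"
    by (rule Lim_transform_eventually)
  then show ?thesis using equal by (simp add: DERIV_def)
qed

lemma C2_on_cubed_positive_part:
  assumes C2: "C2_on S g G H"
  shows "C2_on S (\<lambda>x. (max 0 (g x - c)) ^ 3)
     (\<lambda>x. (3 * (max 0 (g x - c))\<^sup>2) *\<^sub>R G x)
     (\<lambda>x h. (3 * (max 0 (g x - c))\<^sup>2) *\<^sub>R H x h + (6 * max 0 (g x - c) * (G x \<bullet> h)) *\<^sub>R G x)"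
  unfolding C2_on_def
proof (intro conjI ballI allI)
  fix x assume x: "x \<in> S"
  have dg: "((\<lambda>x. g x - c) has_derivative (\<lambda>h. G x \<bullet> h)) (at x)"
    by (intro has_derivative_diff[of g "\<lambda>h. G x \<bullet> h" _ "\<lambda>_. c" "\<lambda>_. 0", simplified])
       (use C2 x in \<open>simp add: C2_on_def\<close>)
  have dG: "(G has_derivative H x) (at x)" using C2 x by (simp add: C2_on_def)
  have 3: "((\<lambda>t. (max 0 t) ^ 3) has_derivative (\<lambda>h. 3 * (max 0 (g x - c))\<^sup>2 * h)) (at (g x - c))"
    using DERIV_max0_power[of 1 "g x - c"]
    by (simp add: numeral_3_eq_3[symmetric] numeral_2_eq_2[symmetric] has_field_derivative_def del: power_Suc)
  from has_derivative_compose[OF dg this]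
  show "((\<lambda>x. (max 0 (g x - c)) ^ 3) has_derivative (\<lambda>h. (3 * (max 0 (g x - c))\<^sup>2) *\<^sub>R G x \<bullet> h)) (at x)"
    by simp
  have 2: "((\<lambda>t. (max 0 t)\<^sup>2) has_derivative (\<lambda>h. 2 * max 0 (g x - c) * h)) (at (g x - c))"
    using DERIV_max0_power[of 0 "g x - c"]
    by (simp add: numeral_2_eq_2[symmetric] has_field_derivative_def del: power_Suc)
  have "((\<lambda>x. 3 * (max 0 (g x - c))\<^sup>2) has_derivative (\<lambda>h. 6 * max 0 (g x - c) * (G x \<bullet> h))) (at x)"
    using has_derivative_mult_right[OF has_derivative_compose[OF dg 2], of 3] by (simp add: mult_ac)
  from has_derivative_scaleR[OF this dG]
  show "((\<lambda>x. (3 * (max 0 (g x - c))\<^sup>2) *\<^sub>R G x) has_derivative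
     (\<lambda>h. (3 * (max 0 (g x - c))\<^sup>2) *\<^sub>R H x h + (6 * max 0 (g x - c) * (G x \<bullet> h)) *\<^sub>R G x)) (at x)" .
next
  fix h
  have "continuous_on S (\<lambda>x. H x h)" using C2 by (simp add: C2_on_def)
  then show "continuous_on S (\<lambda>x. (3 * (max 0 (g x - c))\<^sup>2) *\<^sub>R H x h + (6 * max 0 (g x - c) * (G x \<bullet> h)) *\<^sub>R G x)"
    by (intro continuous_intros C2_on_continuous[OF C2] C2_on_continuous_gradient[OF C2])
qed

section \<open>Behaviour under reflections\<close>

text \<open>The linear part of the reflections with normal vector \<open>\<nu>\<close>.\<close>

definition refl_lin :: "'a::euclidean_space \<Rightarrow> 'a \<Rightarrow> 'a" where
  "refl_lin \<nu> h = h - (2 * (h \<bullet> \<nu>)) *\<^sub>R \<nu>"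

lemma refl_lin_selfadjoint: "refl_lin \<nu> x \<bullet> y = x \<bullet> refl_lin \<nu> y"
  by (simp add: refl_lin_def inner_diff_left inner_diff_right inner_commute)

lemma bounded_linear_refl_lin: "bounded_linear (refl_lin \<nu>)"
  unfolding refl_lin_def
  by (intro bounded_linear_intros)

lemma refl_lin_involution: "norm \<nu> = 1 \<Longrightarrow> refl_lin \<nu> (refl_lin \<nu> x) = x"
  by (simp add: refl_lin_def inner_diff_left algebra_simps norm_eq_1)

text \<open>The trace is invariant under conjugation with a reflection, which makes the Laplacian
  reflection invariant.  Symmetry of \<open>T\<close> plays no role.\<close>

lemma trace_of_refl:
  assumes T: "linear T" and \<nu>: "norm \<nu> = 1"
  shows "trace_of (\<lambda>h. refl_lin \<nu> (T (refl_lin \<nu> h))) = trace_of T"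
proof -
  note A = linear_sum[OF bounded_linear.linear[OF bounded_linear_refl_lin[of \<nu>]]]
    linear_cmul[OF bounded_linear.linear[OF bounded_linear_refl_lin[of \<nu>]]]
  have "T (refl_lin \<nu> b) \<bullet> refl_lin \<nu> b =
      (\<Sum>i\<in>Basis. \<Sum>j\<in>Basis. (refl_lin \<nu> b \<bullet> i) * (refl_lin \<nu> b \<bullet> j) * (T i \<bullet> j))" for b
  proof -
    have "T (refl_lin \<nu> b) = T (\<Sum>i\<in>Basis. (refl_lin \<nu> b \<bullet> i) *\<^sub>R i)"
      by (simp add: euclidean_representation)
    also have "\<dots> = (\<Sum>i\<in>Basis. (refl_lin \<nu> b \<bullet> i) *\<^sub>R T i)"
      by (simp add: linear_sum[OF T] linear_cmul[OF T])
    finally show ?thesis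
      by (simp add: inner_sum_left euclidean_inner[of "T _" "refl_lin \<nu> b"] sum_distrib_left mult_ac)
  qed
  then have "trace_of (\<lambda>h. refl_lin \<nu> (T (refl_lin \<nu> h))) =
      (\<Sum>b\<in>Basis. \<Sum>i\<in>Basis. \<Sum>j\<in>Basis. (refl_lin \<nu> b \<bullet> i) * (refl_lin \<nu> b \<bullet> j) * (T i \<bullet> j))"
    unfolding trace_of_def refl_lin_selfadjoint by simp
  also have "\<dots> = (\<Sum>i\<in>Basis. \<Sum>j\<in>Basis. \<Sum>b\<in>Basis. (refl_lin \<nu> b \<bullet> i) * (refl_lin \<nu> b \<bullet> j) * (T i \<bullet> j))"
    by (subst sum.swap, rule sum.cong[OF refl], rule sum.swap)
  also have "\<dots> = (\<Sum>i\<in>Basis. \<Sum>j\<in>Basis. (if i = j then T i \<bullet> j else 0))"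
  proof (intro sum.cong refl)
    fix i j :: 'a assume ij: "i \<in> Basis" "j \<in> Basis"
    have sym: "refl_lin \<nu> b \<bullet> k = refl_lin \<nu> k \<bullet> b" for b k
      by (metis refl_lin_selfadjoint inner_commute)
    have "(\<Sum>b\<in>Basis. (refl_lin \<nu> b \<bullet> i) * (refl_lin \<nu> b \<bullet> j)) =
        (\<Sum>b\<in>Basis. (refl_lin \<nu> i \<bullet> b) * (refl_lin \<nu> j \<bullet> b))"
      by (rule sum.cong[OF refl]) (metis sym)
    also have "\<dots> = refl_lin \<nu> i \<bullet> refl_lin \<nu> j"
      by (rule euclidean_inner[symmetric])
    also have "\<dots> = i \<bullet> j"
      by (simp add: refl_lin_selfadjoint refl_lin_involution[OF \<nu>])
    finally show "(\<Sum>b\<in>Basis. (refl_lin \<nu> b \<bullet> i) * (refl_lin \<nu> b \<bullet> j) * (T i \<bullet> j)) = (if i = j then T i \<bullet> j else 0)"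
      using ij by (simp add: inner_Basis flip: sum_distrib_right)
  qed
  also have "\<dots> = trace_of T" by (simp add: trace_of_def)
  finally show ?thesis .
qed

lemma has_derivative_reflection: "(reflection \<nu> l has_derivative refl_lin \<nu>) (at x)"
  unfolding reflection_def refl_lin_def
  by (auto intro!: derivative_eq_intros simp: algebra_simps)

lemma continuous_on_reflection: "continuous_on S (reflection \<nu> l)"
  unfolding reflection_def by (intro continuous_intros)

lemma C2_on_reflection:
  assumes C2: "C2_on S g G H" and T: "reflection \<nu> l ` T \<subseteq> S"
  shows "C2_on T (\<lambda>x. g (reflection \<nu> l x)) (\<lambda>x. refl_lin \<nu> (G (reflection \<nu> l x)))
    (\<lambda>x h. refl_lin \<nu> (H (reflection \<nu> l x) (refl_lin \<nu> h)))"
  unfolding C2_on_def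
proof (intro conjI ballI allI)
  fix x assume "x \<in> T"
  then have x: "reflection \<nu> l x \<in> S" using T by blast
  have "(g has_derivative (\<lambda>h. G (reflection \<nu> l x) \<bullet> h)) (at (reflection \<nu> l x))"
    using C2 x by (simp add: C2_on_def)
  from has_derivative_compose[OF has_derivative_reflection this]
  show "((\<lambda>x. g (reflection \<nu> l x)) has_derivative (\<lambda>h. refl_lin \<nu> (G (reflection \<nu> l x)) \<bullet> h)) (at x)"
    by (simp add: refl_lin_selfadjoint)
  have "(G has_derivative H (reflection \<nu> l x)) (at (reflection \<nu> l x))"
    using C2 x by (simp add: C2_on_def)
  from bounded_linear.has_derivative[OF bounded_linear_refl_lin has_derivative_compose[OF has_derivative_reflection this]]
  show "((\<lambda>x. refl_lin \<nu> (G (reflection \<nu> l x))) has_derivative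
      (\<lambda>h. refl_lin \<nu> (H (reflection \<nu> l x) (refl_lin \<nu> h)))) (at x)" .
next
  fix h
  have "continuous_on S (\<lambda>x. H x (refl_lin \<nu> h))" using C2 by (simp add: C2_on_def)
  from continuous_on_compose2[OF this continuous_on_reflection T]
  show "continuous_on T (\<lambda>x. refl_lin \<nu> (H (reflection \<nu> l x) (refl_lin \<nu> h)))"
    by (rule bounded_linear.continuous_on[OF bounded_linear_refl_lin])
qed

lemma trace_of_hessian_reflection:
  assumes "C2_on S g G H" "reflection \<nu> l x \<in> S" "norm \<nu> = 1"
  shows "trace_of (\<lambda>h. refl_lin \<nu> (H (reflection \<nu> l x) (refl_lin \<nu> h))) = trace_of (H (reflection \<nu> l x))"
proof (rule trace_of_refl[OF _ assms(3)])
  have "(G has_derivative H (reflection \<nu> l x)) (at (reflection \<nu> l x))"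
    using assms(1,2) by (simp add: C2_on_def)
  then show "linear (H (reflection \<nu> l x))" by (rule has_derivative_linear)
qed

section \<open>A weighted mean value inequality\<close>

text \<open>A fixed cube containing the ball of radius \<open>3\<close>.  All integrands have their support in the closed
  unit ball, possibly translated by a vector of norm at most \<open>1\<close>, so the cube replaces the whole
  space as domain of integration.\<close>

abbreviation bigbox :: "'a::euclidean_space set" where
  "bigbox \<equiv> cbox (- (3 *\<^sub>R One)) (3 *\<^sub>R One)"

lemma norm_le_imp_mem_bigbox:
  assumes "norm (x::'a::euclidean_space) \<le> 3" shows "x \<in> bigbox"
  unfolding mem_box
proof
  fix i :: 'a assume i: "i \<in> Basis"
  have "\<bar>x \<bullet> i\<bar> \<le> 3" using Basis_le_norm[OF i, of x] assms by linarith
  then show "- (3 *\<^sub>R One) \<bullet> i \<le> x \<bullet> i \<and> x \<bullet> i \<le> 3 *\<^sub>R One \<bullet> i"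
    using i by (simp add: inner_sum_left_Basis abs_le_iff)
qed

lemma integral_subset_support:
  fixes f :: "'a::euclidean_space \<Rightarrow> real"
  assumes "\<And>x. f x \<noteq> 0 \<Longrightarrow> x \<in> S \<and> x \<in> T"
  shows "integral S f = integral T f"
proof -
  have "(\<lambda>x. if x \<in> S then f x else 0) = (\<lambda>x. if x \<in> T then f x else 0)"
    using assms by fastforce
  then show ?thesis
    using integral_restrict_UNIV[of S f] integral_restrict_UNIV[of T f] by simp
qed

text \<open>The integral of a directional derivative of a compactly supported function vanishes: the
  translates of \<open>F\<close> all have the same integral, and the translation parameter may be differentiated
  under the integral.\<close>

lemma integral_directional_derivative_zero:
  fixes F D :: "'a::euclidean_space \<Rightarrow> real"
  assumes der: "\<And>x. ((\<lambda>t. F (x + t *\<^sub>R b)) has_real_derivative D x) (at 0)"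
    and cF: "continuous_on UNIV F" and cD: "continuous_on UNIV D"
    and supp: "\<And>x. norm x > 1 \<Longrightarrow> F x = 0"
    and b: "b \<in> Basis"
  shows "integral bigbox D = 0"
proof -
  define U where "U = {-1..1::real}"
  have at0: "at 0 within U = at 0" by (simp add: U_def at_within_Icc_at)
  have const: "integral bigbox (\<lambda>y. F (y + t *\<^sub>R b)) = integral bigbox F" if "t \<in> U" for t
  proof -
    have nb: "norm (t *\<^sub>R b) \<le> 1" using that b by (auto simp: U_def)
    have "integral bigbox (\<lambda>y. F (y + t *\<^sub>R b)) =
        integral (cbox (- (3 *\<^sub>R One) - t *\<^sub>R b) (3 *\<^sub>R One - t *\<^sub>R b)) (\<lambda>y. F (y + t *\<^sub>R b))"
    proof (rule integral_subset_support)
      fix y assume "F (y + t *\<^sub>R b) \<noteq> 0"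
      then have n1: "norm (y + t *\<^sub>R b) \<le> 1" using supp[of "y + t *\<^sub>R b"] by force
      then have "norm y \<le> 2" using nb norm_triangle_ineq4[of "y + t *\<^sub>R b" "t *\<^sub>R b"] by simp
      moreover have "y + t *\<^sub>R b \<in> bigbox" using n1 by (intro norm_le_imp_mem_bigbox) simp
      ultimately show "y \<in> bigbox \<and> y \<in> cbox (- (3 *\<^sub>R One) - t *\<^sub>R b) (3 *\<^sub>R One - t *\<^sub>R b)"
        using norm_le_imp_mem_bigbox[of y] by (auto simp: mem_box algebra_simps)
    qed
    also have "\<dots> = integral bigbox F" by (rule integral_shift_cbox)
    finally show ?thesis .
  qed
  have "((\<lambda>t. integral bigbox (\<lambda>y. F (y + t *\<^sub>R b))) has_field_derivative
      integral bigbox (\<lambda>y. D (y + 0 *\<^sub>R b))) (at 0 within U)"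
  proof (rule leibniz_rule_field_derivative[where fx="\<lambda>t y. D (y + t *\<^sub>R b)"])
    fix t y
    have "((\<lambda>s. F ((y + t *\<^sub>R b) + s *\<^sub>R b)) has_real_derivative D (y + t *\<^sub>R b)) (at (t + (-t)))"
      using der[of "y + t *\<^sub>R b"] by simp
    then have "((\<lambda>s. F ((y + t *\<^sub>R b) + (s + (-t)) *\<^sub>R b)) has_real_derivative D (y + t *\<^sub>R b)) (at t)"
      by (subst (asm) DERIV_shift)
    then have "((\<lambda>s. F (y + s *\<^sub>R b)) has_real_derivative D (y + t *\<^sub>R b)) (at t)"
      by (simp add: algebra_simps)
    then show "((\<lambda>s. F (y + s *\<^sub>R b)) has_real_derivative D (y + t *\<^sub>R b)) (at t within U)"
      by (rule has_field_derivative_at_within)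
  next
    fix t show "(\<lambda>y. F (y + t *\<^sub>R b)) integrable_on bigbox"
      by (intro integrable_continuous continuous_on_compose2[OF cF] continuous_intros) auto
  next
    show "continuous_on (U \<times> bigbox) (\<lambda>(t, y). D (y + t *\<^sub>R b))"
      unfolding case_prod_unfold
      by (intro continuous_on_compose2[OF cD] continuous_intros) auto
  qed (auto simp: U_def)
  moreover have "((\<lambda>t. integral bigbox (\<lambda>y. F (y + t *\<^sub>R b))) has_field_derivative 0) (at 0 within U)"
    by (rule has_field_derivative_transform_within[where d=1 and f="\<lambda>_. integral bigbox F"])
       (auto simp: const U_def)
  ultimately have "integral bigbox (\<lambda>y. D (y + 0 *\<^sub>R b)) = 0"
    unfolding at0 by (rule DERIV_unique)
  then show ?thesis by simp
qed

text \<open>The averaging kernel \<open>k\<close>.  It is chosen because \<open>k\<^sup>2 / 4\<close> is continuously differentiable with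
  gradient \<open>- k y\<close>, has the same support, and is at most \<open>k / 4\<close>.\<close>

definition bump :: "'a::euclidean_space \<Rightarrow> real" where
  "bump y = max 0 (1 - y \<bullet> y)"

lemma bump_nonneg: "0 \<le> bump y" and bump_le_1: "bump y \<le> 1"
  by (auto simp: bump_def)

lemma continuous_on_bump [continuous_intros]:
  "continuous_on S f \<Longrightarrow> continuous_on S (\<lambda>x. bump (f x))"
  unfolding bump_def by (intro continuous_intros)

lemma bump_eq_0: "norm y \<ge> 1 \<Longrightarrow> bump y = 0"
proof -
  assume "norm y \<ge> 1"
  then have "(norm y)\<^sup>2 \<ge> 1\<^sup>2" by (intro power_mono) auto
  then show ?thesis by (simp add: bump_def power2_norm_eq_inner)
qed

lemma integral_bump_pos: "integral bigbox (bump :: 'a::euclidean_space \<Rightarrow> real) > 0"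
proof -
  have cont: "continuous_on S (bump :: 'a \<Rightarrow> real)" for S
    using continuous_on_bump[OF continuous_on_id, of S] by simp
  have "integral bigbox (bump :: 'a \<Rightarrow> real) \<ge> 0"
    by (intro integral_nonneg integrable_continuous cont) (simp add: bump_nonneg)
  moreover have "integral bigbox (bump :: 'a \<Rightarrow> real) \<noteq> 0"
  proof
    assume *: "integral bigbox (bump :: 'a \<Rightarrow> real) = 0"
    then have "(bump has_integral 0) (bigbox :: 'a set)"
      using integrable_integral[OF integrable_continuous[OF cont]] by metis
    moreover have "box (- (3 *\<^sub>R One)) (3 *\<^sub>R One) \<noteq> ({} :: 'a set)"
      by (auto simp: box_ne_empty inner_sum_left_Basis)
    moreover have "0 \<in> (bigbox :: 'a set)" by (rule norm_le_imp_mem_bigbox) simp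
    ultimately have "bump (0::'a) = 0"
      using has_integral_0_cbox_imp_0[OF cont, of "- (3 *\<^sub>R One)" "3 *\<^sub>R One" 0] bump_nonneg by blast
    then show False by (simp add: bump_def)
  qed
  ultimately show ?thesis by simp
qed

lemma bump_square_derivative:
  fixes y b :: "'a::euclidean_space"
  shows "((\<lambda>t. (bump (y + t *\<^sub>R b))\<^sup>2 / 4) has_real_derivative - (bump y * (y \<bullet> b))) (at 0)"
proof -
  have 1: "((\<lambda>t. 1 - (y + t *\<^sub>R b) \<bullet> (y + t *\<^sub>R b)) has_real_derivative (-2 * (y \<bullet> b))) (at 0)"
    unfolding inner_add_left inner_add_right
    by (auto intro!: derivative_eq_intros simp: inner_commute)
  have 2: "((\<lambda>t. (max 0 t) ^ 2) has_real_derivative 2 * bump y) (at (1 - (y + 0 *\<^sub>R b) \<bullet> (y + 0 *\<^sub>R b)))"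
    using DERIV_max0_power[of 0 "1 - y \<bullet> y"] by (simp add: bump_def numeral_2_eq_2)
  have "((\<lambda>t. (bump (y + t *\<^sub>R b))^2) has_real_derivative (2 * bump y) * (-2 * (y \<bullet> b))) (at 0)"
    using DERIV_chain2[OF 2 1] by (simp add: bump_def)
  from DERIV_cdivide[OF this, of 4] show ?thesis by (simp add: algebra_simps)
qed

text \<open>Integration by parts, using that \<open>- bump y *\<^sub>R y\<close> is the gradient of \<open>(bump y)\<^sup>2 / 4\<close>.  The left-hand
  side is the derivative in \<open>s\<close> of the average of \<open>V (x0 + s *\<^sub>R y)\<close> against the kernel.\<close>

lemma divergence_identity:
  fixes V :: "'a::euclidean_space \<Rightarrow> real"
  assumes C2: "C2_on UNIV V G H"
  shows "integral bigbox (\<lambda>y. (G (x0 + s *\<^sub>R y) \<bullet> y) * bump y) =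
    s * integral bigbox (\<lambda>y. trace_of (H (x0 + s *\<^sub>R y)) * ((bump y)\<^sup>2 / 4))"
proof -
  note cG = continuous_on_compose2[OF C2_on_continuous_gradient[OF C2]]
  have cH0: "continuous_on UNIV (\<lambda>x. H x h)" for h using C2 by (simp add: C2_on_def)
  note cH = continuous_on_compose2[OF cH0]
  have dG: "(G has_derivative H x) (at x)" for x using C2 by (simp add: C2_on_def)
  \<comment> \<open>\<open>D b\<close> is the derivative in direction \<open>b\<close> of \<open>y \<mapsto> (G (x0 + s *\<^sub>R y) \<bullet> b) * ((bump y)\<^sup>2 / 4)\<close>\<close>
  define D where "D b y = s * (H (x0 + s *\<^sub>R y) b \<bullet> b) * ((bump y)\<^sup>2 / 4)
      - (G (x0 + s *\<^sub>R y) \<bullet> b) * (bump y * (y \<bullet> b))" for b y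
  have cD: "continuous_on UNIV (D b)" for b
    unfolding D_def by (intro continuous_intros cG cH) auto
  have D0: "integral bigbox (D b) = 0" if b: "b \<in> Basis" for b
  proof (rule integral_directional_derivative_zero[OF _ _ cD _ b])
    let ?F = "\<lambda>y. (G (x0 + s *\<^sub>R y) \<bullet> b) * ((bump y)\<^sup>2 / 4)"
    show "continuous_on UNIV ?F" by (intro continuous_intros cG) auto
    show "?F x = 0" if "norm x > 1" for x using that by (simp add: bump_eq_0)
    fix y
    have lin: "H x (c *\<^sub>R h) = c *\<^sub>R H x h" for x c h
      using has_derivative_linear[OF dG[of x]] by (simp add: linear_cmul)
    have "((\<lambda>t. x0 + s *\<^sub>R (y + t *\<^sub>R b)) has_derivative (\<lambda>t. t *\<^sub>R (s *\<^sub>R b))) (at 0)"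
      by (auto intro!: derivative_eq_intros simp: algebra_simps)
    moreover have "(G has_derivative H (x0 + s *\<^sub>R y)) (at (x0 + s *\<^sub>R (y + 0 *\<^sub>R b)))"
      using dG by simp
    ultimately have "((\<lambda>t. G (x0 + s *\<^sub>R (y + t *\<^sub>R b))) has_derivative
        (\<lambda>t. H (x0 + s *\<^sub>R y) (t *\<^sub>R (s *\<^sub>R b)))) (at 0)"
      by (rule has_derivative_compose)
    then have "((\<lambda>t. G (x0 + s *\<^sub>R (y + t *\<^sub>R b)) \<bullet> b) has_derivative
        (\<lambda>t. H (x0 + s *\<^sub>R y) (t *\<^sub>R (s *\<^sub>R b)) \<bullet> b)) (at 0)"
      by (rule has_derivative_inner_left)
    then have "((\<lambda>t. G (x0 + s *\<^sub>R (y + t *\<^sub>R b)) \<bullet> b) has_real_derivative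
        s * (H (x0 + s *\<^sub>R y) b \<bullet> b)) (at 0)"
      by (rule has_derivative_imp_has_field_derivative) (simp add: lin)
    from DERIV_mult[OF this bump_square_derivative[of y b]]
    show "((\<lambda>t. ?F (y + t *\<^sub>R b)) has_real_derivative D b y) (at 0)"
      by (simp add: D_def algebra_simps)
  qed
  have "integral bigbox (\<lambda>y. \<Sum>b\<in>Basis. D b y) = (\<Sum>b\<in>Basis. integral bigbox (D b))"
    by (intro integral_sum integrable_continuous continuous_on_subset[OF cD]) auto
  also have "\<dots> = 0" by (simp add: D0)
  finally have z: "integral bigbox (\<lambda>y. \<Sum>b\<in>Basis. D b y) = 0" .
  have "(\<Sum>b\<in>Basis. D b y) = s * (trace_of (H (x0 + s *\<^sub>R y)) * ((bump y)\<^sup>2 / 4))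
      - (G (x0 + s *\<^sub>R y) \<bullet> y) * bump y" for y
    by (simp add: D_def sum_subtractf trace_of_def euclidean_inner[of "G (x0 + s *\<^sub>R y)" y]
      sum_distrib_left sum_distrib_right mult_ac)
  with z have "integral bigbox (\<lambda>y. s * (trace_of (H (x0 + s *\<^sub>R y)) * ((bump y)\<^sup>2 / 4))
      - (G (x0 + s *\<^sub>R y) \<bullet> y) * bump y) = 0" by simp
  moreover have "(\<lambda>y. s * (trace_of (H (x0 + s *\<^sub>R y)) * ((bump y)\<^sup>2 / 4))) integrable_on bigbox"
    unfolding trace_of_def by (intro integrable_continuous continuous_intros cH) auto
  moreover have "(\<lambda>y. (G (x0 + s *\<^sub>R y) \<bullet> y) * bump y) integrable_on bigbox"
    by (intro integrable_continuous continuous_intros cG) auto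
  ultimately show ?thesis by (simp add: integral_diff)
qed

text \<open>A sub-mean-value inequality for functions with \<open>\<Delta>V \<ge> -c\<close>.  The weighted average \<open>A s\<close> over the
  ball of radius \<open>s\<close> around \<open>x0\<close> satisfies \<open>A' s \<ge> - s c \<kappa> / 4\<close>, where \<open>\<kappa>\<close> is the mass of the
  kernel; integrate from \<open>0\<close> to \<open>r\<close>.\<close>

lemma weighted_mean_value:
  fixes V :: "'a::euclidean_space \<Rightarrow> real"
  assumes C2: "C2_on UNIV V G H"
    and lower: "\<And>x. trace_of (H x) \<ge> - c" and c: "c \<ge> 0" and r: "r \<ge> 0"
  shows "V x0 * integral bigbox (bump :: 'a \<Rightarrow> real) \<le>
    integral bigbox (\<lambda>y. V (x0 + r *\<^sub>R y) * bump y) + c * r\<^sup>2 / 8 * integral bigbox (bump :: 'a \<Rightarrow> real)"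
proof -
  let ?\<kappa> = "integral bigbox (bump :: 'a \<Rightarrow> real)"
  note cV = continuous_on_compose2[OF C2_on_continuous[OF C2]]
  note cG = continuous_on_compose2[OF C2_on_continuous_gradient[OF C2]]
  have cH0: "continuous_on UNIV (\<lambda>x. H x h)" for h using C2 by (simp add: C2_on_def)
  note cH = continuous_on_compose2[OF cH0]
  have dV: "(V has_derivative (\<lambda>h. G x \<bullet> h)) (at x)" for x using C2 by (simp add: C2_on_def)
  \<comment> \<open>the weighted average of \<open>V\<close> over the ball of radius \<open>s\<close>\<close>
  define A where "A s = integral bigbox (\<lambda>y. V (x0 + s *\<^sub>R y) * bump y)" for s
  have dA: "(A has_real_derivative integral bigbox (\<lambda>y. (G (x0 + s *\<^sub>R y) \<bullet> y) * bump y)) (at s)" for s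
    unfolding A_def
  proof (rule leibniz_rule_field_derivative[where U=UNIV and fx="\<lambda>s y. (G (x0 + s *\<^sub>R y) \<bullet> y) * bump y"])
    fix s y
    have "((\<lambda>s. x0 + s *\<^sub>R y) has_derivative (\<lambda>t. t *\<^sub>R y)) (at s)"
      by (auto intro!: derivative_eq_intros)
    from has_derivative_compose[OF this dV]
    have "((\<lambda>s. V (x0 + s *\<^sub>R y)) has_real_derivative G (x0 + s *\<^sub>R y) \<bullet> y) (at s)"
      by (rule has_derivative_imp_has_field_derivative) simp
    from DERIV_cmult_right[OF this]
    show "((\<lambda>s. V (x0 + s *\<^sub>R y) * bump y) has_real_derivative (G (x0 + s *\<^sub>R y) \<bullet> y) * bump y) (at s)" .
  next
    fix s show "(\<lambda>y. V (x0 + s *\<^sub>R y) * bump y) integrable_on bigbox"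
      by (intro integrable_continuous continuous_intros cV) auto
  next
    show "continuous_on (UNIV \<times> bigbox) (\<lambda>(s, y). (G (x0 + s *\<^sub>R y) \<bullet> y) * bump y)"
      unfolding case_prod_unfold by (intro continuous_intros cG) auto
  qed auto
  have lb: "integral bigbox (\<lambda>y. trace_of (H (x0 + s *\<^sub>R y)) * ((bump y)\<^sup>2 / 4)) \<ge> - (c / 4 * ?\<kappa>)" for s
  proof -
    have "integral bigbox (\<lambda>y::'a. - (c / 4) * bump y) \<le>
        integral bigbox (\<lambda>y. trace_of (H (x0 + s *\<^sub>R y)) * ((bump y)\<^sup>2 / 4))"
    proof (rule integral_le)
      show "(\<lambda>y::'a. - (c / 4) * bump y) integrable_on bigbox"
        by (intro integrable_continuous continuous_intros)
      show "(\<lambda>y. trace_of (H (x0 + s *\<^sub>R y)) * ((bump y)\<^sup>2 / 4)) integrable_on bigbox"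
        unfolding trace_of_def by (intro integrable_continuous continuous_intros cH) auto
      fix y :: 'a
      have "(bump y)\<^sup>2 \<le> bump y"
        using mult_left_le[OF bump_le_1 bump_nonneg] by (simp add: power2_eq_square)
      then have "c * (bump y)\<^sup>2 \<le> c * bump y" using c by (rule mult_left_mono)
      moreover have "- c * ((bump y)\<^sup>2 / 4) \<le> trace_of (H (x0 + s *\<^sub>R y)) * ((bump y)\<^sup>2 / 4)"
        by (intro mult_right_mono lower) simp
      ultimately show "- (c / 4) * bump y \<le> trace_of (H (x0 + s *\<^sub>R y)) * ((bump y)\<^sup>2 / 4)"
        by linarith
    qed
    then show ?thesis by simp
  qed
  have "A 0 + c / 8 * ?\<kappa> * 0\<^sup>2 \<le> A r + c / 8 * ?\<kappa> * r\<^sup>2"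
  proof (rule DERIV_nonneg_imp_nondecreasing[OF r])
    fix s assume s: "0 \<le> s" "s \<le> r"
    let ?I = "integral bigbox (\<lambda>y. trace_of (H (x0 + s *\<^sub>R y)) * ((bump y)\<^sup>2 / 4))"
    have "((\<lambda>s. A s + c / 8 * ?\<kappa> * s\<^sup>2) has_real_derivative s * ?I + c / 8 * ?\<kappa> * (2 * s)) (at s)"
      using dA[of s] unfolding divergence_identity[OF C2]
      by (auto intro!: derivative_eq_intros)
    moreover have "s * ?I + c / 8 * ?\<kappa> * (2 * s) \<ge> 0"
    proof -
      have "s * (?I + c / 4 * ?\<kappa>) \<ge> 0" using s lb[of s] by (intro mult_nonneg_nonneg) auto
      then show ?thesis by (simp add: algebra_simps)
    qed
    ultimately show "\<exists>y. ((\<lambda>s. A s + c / 8 * ?\<kappa> * s\<^sup>2) has_real_derivative y) (at s) \<and> 0 \<le> y"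
      by (intro exI conjI)
  qed
  then show ?thesis by (simp add: A_def algebra_simps)
qed

section \<open>Maximum principles\<close>

lemma positive_maximum_interior:
  fixes S :: "'a::euclidean_space set" and \<phi> :: "'a \<Rightarrow> real"
  assumes S: "open S" "bounded S" and cont: "continuous_on (closure S) \<phi>"
    and bd: "\<And>x. x \<in> frontier S \<Longrightarrow> \<phi> x \<le> 0" and z: "z \<in> S" "\<phi> z > 0"
  obtains x0 where "x0 \<in> S" "\<phi> x0 > 0" "\<And>y. y \<in> S \<Longrightarrow> \<phi> y \<le> \<phi> x0"
proof -
  have "compact (closure S)" using S(2) by simp
  then obtain x0 where x0: "x0 \<in> closure S" "\<And>y. y \<in> closure S \<Longrightarrow> \<phi> y \<le> \<phi> x0"
    using continuous_attains_sup[OF _ _ cont] z(1) closure_subset by blast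
  then have le: "\<phi> y \<le> \<phi> x0" if "y \<in> S" for y using that closure_subset by blast
  then have "\<phi> x0 > 0" using z by fastforce
  moreover from this have "x0 \<in> S"
    using x0(1) bd S(1) by (force simp: frontier_def interior_open)
  ultimately show ?thesis using le that by blast
qed

text \<open>The second derivative test, applied along each coordinate direction.\<close>

lemma trace_nonpos_at_max:
  fixes g :: "'a::euclidean_space \<Rightarrow> real"
  assumes C2: "C2_on S g G H" and S: "open S" and x: "x \<in> S"
    and max: "\<And>y. y \<in> S \<Longrightarrow> g y \<le> g x"
  shows "trace_of (H x) \<le> 0"
  unfolding trace_of_def
proof (rule sum_nonpos)
  fix b :: 'a assume b: "b \<in> Basis"
  obtain e where e: "e > 0" "ball x e \<subseteq> S" using S x open_contains_ball by blast
  have inS: "x + t *\<^sub>R b \<in> S" if "\<bar>t\<bar> < e" for t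
    using e that b by (auto simp: dist_norm subset_eq)
  have line: "((\<lambda>t. x + t *\<^sub>R b) has_derivative (\<lambda>s. s *\<^sub>R b)) (at t)" for t
    by (auto intro!: derivative_eq_intros)
  have d1: "((\<lambda>t. g (x + t *\<^sub>R b)) has_real_derivative G (x + t *\<^sub>R b) \<bullet> b) (at t)" if "\<bar>t\<bar> < e" for t
  proof -
    have "(g has_derivative (\<lambda>h. G (x + t *\<^sub>R b) \<bullet> h)) (at (x + t *\<^sub>R b))"
      using C2 inS[OF that] by (simp add: C2_on_def)
    from has_derivative_compose[OF line this] show ?thesis
      by (rule has_derivative_imp_has_field_derivative) simp
  qed
  have d2: "((\<lambda>t. G (x + t *\<^sub>R b) \<bullet> b) has_real_derivative H x b \<bullet> b) (at 0)"
  proof -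
    have G': "(G has_derivative H x) (at (x + 0 *\<^sub>R b))" using C2 x by (simp add: C2_on_def)
    have "linear (H x)" using has_derivative_linear[OF G'] .
    then show ?thesis
      using has_derivative_inner_left[OF has_derivative_compose[OF line G'], of b]
      by (intro has_derivative_imp_has_field_derivative) (auto simp: linear_cmul)
  qed
  have G0: "G x \<bullet> b = 0"
    using DERIV_local_max[OF d1[of 0] e(1)] e(1) max inS by simp
  show "H x b \<bullet> b \<le> 0"
  proof (rule ccontr)
    assume "\<not> ?thesis"
    then obtain d where d: "d > 0" "\<And>h. h > 0 \<Longrightarrow> h < d \<Longrightarrow> 0 < G (x + h *\<^sub>R b) \<bullet> b"
      using DERIV_pos_inc_right[OF d2] G0 by auto
    define t where "t = min d e / 2"
    have t: "0 < t" "t < d" "t < e" using d(1) e(1) by (auto simp: t_def)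
    have "\<exists>z>0. z < t \<and> g (x + t *\<^sub>R b) - g (x + 0 *\<^sub>R b) = (t - 0) * (G (x + z *\<^sub>R b) \<bullet> b)"
      by (rule MVT2[OF t(1)]) (use d1 t in auto)
    then obtain z where z: "0 < z" "z < t" "g (x + t *\<^sub>R b) - g x = t * (G (x + z *\<^sub>R b) \<bullet> b)"
      by auto
    have "t * (G (x + z *\<^sub>R b) \<bullet> b) > 0" using d z t by simp
    with z(3) max[OF inS[of t]] t show False by simp
  qed
qed

lemma strict_subharmonic_maximum_principle:
  fixes S :: "'a::euclidean_space set" and \<phi> :: "'a \<Rightarrow> real"
  assumes S: "open S" "bounded S" and C2: "C2_on S \<phi> G H"
    and cont: "continuous_on (closure S) \<phi>"
    and bd: "\<And>x. x \<in> frontier S \<Longrightarrow> \<phi> x \<le> 0"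
    and sub: "\<And>x. x \<in> S \<Longrightarrow> \<phi> x > 0 \<Longrightarrow> trace_of (H x) > 0"
    and z: "z \<in> S"
  shows "\<phi> z \<le> 0"
proof (rule ccontr)
  assume "\<not> ?thesis"
  then have "\<phi> z > 0" by simp
  then obtain x0 where "x0 \<in> S" "\<phi> x0 > 0" "\<And>y. y \<in> S \<Longrightarrow> \<phi> y \<le> \<phi> x0"
    using positive_maximum_interior[OF S cont bd z] by blast
  then show False using trace_nonpos_at_max[OF C2 S(1)] sub by fastforce
qed

text \<open>The exponent three makes the truncation twice continuously differentiable.  Since \<open>\<phi> \<le> 0\<close> on the
  frontier, the set where \<open>\<phi> \<ge> \<epsilon>\<close> is a closed subset of \<open>S\<close>, and the function vanishes off it, so
  the extension by zero keeps this regularity.\<close>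

lemma C2_on_cubed_positive_part_extension:
  fixes S :: "'a::euclidean_space set"
  assumes S: "open S" "bounded S" and C2: "C2_on S \<phi> G H"
    and cont: "continuous_on (closure S) \<phi>" and bd: "\<And>x. x \<in> frontier S \<Longrightarrow> \<phi> x \<le> 0"
    and e: "\<epsilon> > 0"
  shows "C2_on UNIV (\<lambda>x. if x \<in> S then (max 0 (\<phi> x - \<epsilon>)) ^ 3 else 0)
     (\<lambda>x. if x \<in> S then (3 * (max 0 (\<phi> x - \<epsilon>))\<^sup>2) *\<^sub>R G x else 0)
     (\<lambda>x. if x \<in> S then (\<lambda>h. (3 * (max 0 (\<phi> x - \<epsilon>))\<^sup>2) *\<^sub>R H x h + (6 * max 0 (\<phi> x - \<epsilon>) * (G x \<bullet> h)) *\<^sub>R G x)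
        else (\<lambda>h. 0))" (is "C2_on UNIV ?V ?G ?H")
proof -
  define K where "K = closure S \<inter> \<phi> -` {\<epsilon>..}"
  have "closed K" unfolding K_def by (rule continuous_closed_preimage[OF cont]) auto
  have KS: "K \<subseteq> S"
    using bd e S(1) by (force simp: K_def frontier_def interior_open)
  have "C2_on S ?V ?G ?H"
    by (rule C2_on_cong[OF C2_on_cubed_positive_part[OF C2, of \<epsilon>] S(1)]) auto
  moreover have "C2_on (- K) ?V ?G ?H"
  proof (rule C2_on_cong[where g="\<lambda>_. 0" and G="\<lambda>_. 0" and H="\<lambda>_ _. 0"])
    show "C2_on (- K) (\<lambda>_. 0) (\<lambda>_. 0) (\<lambda>_ _. 0 :: 'a)" by (simp add: C2_on_def)
    show "open (- K)" using \<open>closed K\<close> by (simp add: open_Compl)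
    have z: "max 0 (\<phi> x - \<epsilon>) = 0" if "x \<in> - K" "x \<in> S" for x
      using that closure_subset[of S] by (auto simp: K_def)
    fix x assume "x \<in> - K"
    then show "0 = ?V x" "0 = ?G x" "(\<lambda>h. 0) = ?H x" using z by auto
  qed
  moreover have "open (- K)" using \<open>closed K\<close> by (simp add: open_Compl)
  ultimately have "C2_on (S \<union> - K) ?V ?G ?H" using S(1) by (intro C2_on_Un)
  moreover have "S \<union> - K = UNIV" using KS by blast
  ultimately show ?thesis by simp
qed

lemma integral_rescaled_le_measure:
  fixes V :: "'a::euclidean_space \<Rightarrow> real"
  assumes S: "open S" "bounded S" and r: "r > 0" and V: "continuous_on UNIV V"
    and ub: "\<And>x. V x \<le> M * indicator S x" and M: "M \<ge> 0"
  shows "integral bigbox (\<lambda>y. V (x0 + r *\<^sub>R y) * bump y) \<le> M * (measure lebesgue S / r ^ DIM('a))"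
proof -
  \<comment> \<open>the preimage of \<open>S\<close> under \<open>y \<mapsto> x0 + r *\<^sub>R y\<close>, written as an image to use the scaling of measure\<close>
  define T where "T = (\<lambda>x. (1 / r) *\<^sub>R x + (- ((1 / r) *\<^sub>R x0))) ` S"
  have mT: "measure lebesgue T = measure lebesgue S / r ^ DIM('a)"
    unfolding T_def measure_lebesgue_affine using r by (simp add: power_divide)
  have memT: "y \<in> T \<longleftrightarrow> x0 + r *\<^sub>R y \<in> S" for y
  proof
    assume "x0 + r *\<^sub>R y \<in> S"
    then show "y \<in> T" unfolding T_def
      by (rule rev_image_eqI) (use r in \<open>simp add: scaleR_add_right\<close>)
  qed (use r in \<open>auto simp: T_def algebra_simps\<close>)
  have "T = (\<lambda>y. x0 + r *\<^sub>R y) -` S" using memT by auto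
  then have "open T" using S(1) by (simp only:) (intro open_vimage continuous_intros)
  moreover have "bounded T" unfolding T_def
    using bounded_translation[OF bounded_scaling[OF S(2), of "1 / r"], of "- ((1 / r) *\<^sub>R x0)"]
    by (simp add: image_image algebra_simps)
  ultimately have T: "T \<in> lmeasurable" by (simp add: lmeasurable_open)
  then have ind: "(indicator T has_integral measure lebesgue T) UNIV"
    by (simp add: lmeasurable_iff_has_integral)
  have le: "V (x0 + r *\<^sub>R y) * bump y \<le> M * indicator T y" for y
  proof -
    have "V (x0 + r *\<^sub>R y) * bump y \<le> (M * indicator S (x0 + r *\<^sub>R y)) * bump y"
      by (intro mult_right_mono ub bump_nonneg)
    also have "\<dots> \<le> (M * indicator S (x0 + r *\<^sub>R y)) * 1"
      by (intro mult_left_mono bump_le_1) (simp add: M)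
    also have "\<dots> = M * indicator T y" by (simp add: memT indicator_def)
    finally show ?thesis .
  qed
  have cont: "continuous_on UNIV (\<lambda>y. V (x0 + r *\<^sub>R y) * bump y)"
    by (intro continuous_intros continuous_on_compose2[OF V]) auto
  have "integral bigbox (\<lambda>y. V (x0 + r *\<^sub>R y) * bump y) \<le> M * measure lebesgue T"
  proof (rule has_integral_le)
    have "((\<lambda>y. V (x0 + r *\<^sub>R y) * bump y) has_integral integral bigbox (\<lambda>y. V (x0 + r *\<^sub>R y) * bump y)) bigbox"
      by (intro integrable_integral integrable_continuous continuous_on_subset[OF cont]) auto
    then show "((\<lambda>y. V (x0 + r *\<^sub>R y) * bump y) has_integral integral bigbox (\<lambda>y. V (x0 + r *\<^sub>R y) * bump y)) UNIV"
    proof (rule has_integral_on_superset)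
      fix y :: 'a assume "y \<notin> bigbox"
      then have "norm y \<ge> 1" using norm_le_imp_mem_bigbox[of y] by linarith
      then show "V (x0 + r *\<^sub>R y) * bump y = 0" by (simp add: bump_eq_0)
    qed auto
    show "((\<lambda>y. M * indicator T y) has_integral M * measure lebesgue T) UNIV"
      using ind by (rule has_integral_mult_right)
  qed (rule le)
  then show ?thesis by (simp add: mT)
qed

text \<open>The maximum principle in sets of small measure.  The bound \<open>\<delta>\<close> depends only on \<open>L\<close> and the
  dimension.\<close>

lemma small_volume_maximum_principle:
  fixes L :: real
  assumes L: "L > 0"
  shows "\<exists>\<delta>>0. \<forall>(S :: 'a::euclidean_space set) \<phi> G H.
     open S \<longrightarrow> bounded S \<longrightarrow> C2_on S \<phi> G H \<longrightarrow> continuous_on (closure S) \<phi> \<longrightarrow>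
     (\<forall>x\<in>frontier S. \<phi> x \<le> 0) \<longrightarrow> (\<forall>x\<in>S. \<phi> x > 0 \<longrightarrow> - trace_of (H x) \<le> L * \<phi> x) \<longrightarrow>
     measure lebesgue S \<le> \<delta> \<longrightarrow> (\<forall>x\<in>S. \<phi> x \<le> 0)"
proof -
  define \<kappa> where "\<kappa> = integral bigbox (bump :: 'a \<Rightarrow> real)"
  have \<kappa>: "\<kappa> > 0" unfolding \<kappa>_def by (rule integral_bump_pos)
  \<comment> \<open>the radius for which the error term \<open>3 L M\<^sup>3 r\<^sup>2 / 8\<close> in the mean value inequality is \<open>M\<^sup>3 / 4\<close>\<close>
  define r where "r = sqrt (2 / (3 * L))"
  have r: "r > 0" "r\<^sup>2 = 2 / (3 * L)" using L by (auto simp: r_def)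
  show ?thesis
  proof (intro exI[of _ "\<kappa> * r ^ DIM('a) / 8"] conjI allI impI)
    show "0 < \<kappa> * r ^ DIM('a) / 8" using \<kappa> r by simp
    fix S :: "'a set" and \<phi> G H
    assume S: "open S" "bounded S" and C2: "C2_on S \<phi> G H" and cont: "continuous_on (closure S) \<phi>"
      and bd: "\<forall>x\<in>frontier S. \<phi> x \<le> 0" and ineq: "\<forall>x\<in>S. \<phi> x > 0 \<longrightarrow> - trace_of (H x) \<le> L * \<phi> x"
      and small: "measure lebesgue S \<le> \<kappa> * r ^ DIM('a) / 8"
    show "\<forall>x\<in>S. \<phi> x \<le> 0"
    proof (rule ccontr)
      assume "\<not> ?thesis"
      then obtain z where z: "z \<in> S" "\<phi> z > 0" by force
      obtain x0 where x0S: "x0 \<in> S" and x0: "\<phi> x0 > 0" "\<And>y. y \<in> S \<Longrightarrow> \<phi> y \<le> \<phi> x0"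
        using positive_maximum_interior[OF S cont _ z] bd by blast
      define M where "M = \<phi> x0"
      have M: "M > 0" using x0(1) by (simp add: M_def)
      have leM: "\<phi> x \<le> M" if "x \<in> S" for x using x0(2)[OF that] by (simp add: M_def)
      \<comment> \<open>small enough that \<open>(M - \<epsilon>)\<^sup>3 > 3 / 8 * M\<^sup>3\<close>\<close>
      define \<epsilon> where "\<epsilon> = M / 8"
      have e: "\<epsilon> > 0" using M by (simp add: \<epsilon>_def)
      define V where "V = (\<lambda>x. if x \<in> S then (max 0 (\<phi> x - \<epsilon>)) ^ 3 else 0)"
      define G' where "G' = (\<lambda>x. if x \<in> S then (3 * (max 0 (\<phi> x - \<epsilon>))\<^sup>2) *\<^sub>R G x else 0)"
      define H' where "H' = (\<lambda>x. if x \<in> S then (\<lambda>h. (3 * (max 0 (\<phi> x - \<epsilon>))\<^sup>2) *\<^sub>R H x h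
         + (6 * max 0 (\<phi> x - \<epsilon>) * (G x \<bullet> h)) *\<^sub>R G x) else (\<lambda>h. 0))"
      have C2V: "C2_on UNIV V G' H'"
        unfolding V_def G'_def H'_def using C2_on_cubed_positive_part_extension[OF S C2 cont _ e] bd by blast
      have lower: "trace_of (H' x) \<ge> - (3 * L * M ^ 3)" for x
      proof (cases "x \<in> S \<and> \<phi> x > \<epsilon>")
        case True
        define m where "m = \<phi> x - \<epsilon>"
        have m: "0 < m" "m \<le> M" "\<phi> x \<le> M" "\<phi> x > 0" using True leM[of x] e by (auto simp: m_def)
        have "H' x = (\<lambda>h. (3 * m\<^sup>2) *\<^sub>R H x h + (6 * m * (G x \<bullet> h)) *\<^sub>R G x)"
          using True by (simp add: H'_def m_def)
        then have "trace_of (H' x) = 3 * m\<^sup>2 * trace_of (H x) + 6 * m * (G x \<bullet> G x)"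
          by (simp only: trace_of_add_rank_one)
        moreover have "6 * m * (G x \<bullet> G x) \<ge> 0" using m by simp
        moreover have "3 * m\<^sup>2 * trace_of (H x) \<ge> - (3 * L * M ^ 3)"
        proof -
          have "L * \<phi> x \<le> L * M" using m L by simp
          then have "- trace_of (H x) \<le> L * M" using ineq True m by force
          then have "3 * m\<^sup>2 * (- trace_of (H x)) \<le> 3 * m\<^sup>2 * (L * M)" by (intro mult_left_mono) auto
          also have "\<dots> \<le> 3 * M\<^sup>2 * (L * M)" using m L M by (intro mult_right_mono mult_left_mono power_mono) auto
          finally show ?thesis by (simp add: power2_eq_square power3_eq_cube mult_ac)
        qed
        ultimately show ?thesis by linarith
      next
        case False
        then have "trace_of (H' x) = 0" by (auto simp: H'_def trace_of_def)
        then show ?thesis using L M by simp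
      qed
      have "V x \<le> M ^ 3 * indicator S x" for x
        using leM[of x] e M by (auto simp: V_def intro!: power_mono)
      then have "integral bigbox (\<lambda>y. V (x0 + r *\<^sub>R y) * bump y) \<le> M ^ 3 * (measure lebesgue S / r ^ DIM('a))"
        using M by (intro integral_rescaled_le_measure[OF S r(1) C2_on_continuous[OF C2V]]) auto
      also have "\<dots> \<le> M ^ 3 * (\<kappa> / 8)"
        using small r M by (intro mult_left_mono) (auto simp: field_simps)
      finally have "V x0 * \<kappa> \<le> M ^ 3 * (\<kappa> / 8) + 3 * L * M ^ 3 * r\<^sup>2 / 8 * \<kappa>"
        using weighted_mean_value[OF C2V lower, of r x0] r L M unfolding \<kappa>_def by simp
      also have "\<dots> = 3 / 8 * M ^ 3 * \<kappa>" using L by (simp add: r field_simps)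
      finally have "V x0 \<le> 3 / 8 * M ^ 3" using \<kappa> by simp
      moreover have "V x0 = (7 / 8 * M) ^ 3" using x0S M by (simp add: V_def \<epsilon>_def flip: M_def)
      moreover have "M ^ 3 > 0" using M by simp
      ultimately show False by (simp add: power_mult_distrib power3_eq_cube)
    qed
  qed
qed

section \<open>Caps and singular solutions\<close>

lemma open_cap: "open \<Omega> \<Longrightarrow> open (cap \<Omega> \<nu> l)"
proof -
  assume "open \<Omega>"
  have "cap \<Omega> \<nu> l = \<Omega> \<inter> {x. \<nu> \<bullet> x < l}" by (auto simp: cap_def inner_commute)
  then show ?thesis using \<open>open \<Omega>\<close> by (simp add: open_Int open_halfspace_lt)
qed

lemma frontier_cap_cases:
  assumes "open \<Omega>" "x \<in> frontier (cap \<Omega> \<nu> l)"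
  shows "x \<in> frontier \<Omega> \<or> x \<bullet> \<nu> = l"
proof -
  have op: "open (cap \<Omega> \<nu> l)" by (rule open_cap[OF assms(1)])
  have cl: "x \<in> closure (cap \<Omega> \<nu> l)" and "x \<notin> cap \<Omega> \<nu> l"
    using assms(2) op by (auto simp: frontier_def interior_open)
  have "closure (cap \<Omega> \<nu> l) \<subseteq> closure \<Omega>" by (rule closure_mono) (auto simp: cap_def)
  moreover have "closure (cap \<Omega> \<nu> l) \<subseteq> {x. \<nu> \<bullet> x \<le> l}"
    by (rule closure_minimal[OF _ closed_halfspace_le]) (auto simp: cap_def inner_commute)
  ultimately have "x \<in> closure \<Omega>" "x \<bullet> \<nu> \<le> l" using cl by (auto simp: inner_commute)
  then show ?thesis
    using \<open>x \<notin> cap \<Omega> \<nu> l\<close> assms(1) by (auto simp: frontier_def interior_open cap_def)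
qed

lemma reflection_closure_cap:
  assumes "reflection \<nu> l ` cap \<Omega> \<nu> l \<subseteq> \<Omega>"
  shows "reflection \<nu> l ` closure (cap \<Omega> \<nu> l) \<subseteq> closure \<Omega>"
  using assms closure_subset by (intro image_closure_subset continuous_on_reflection) auto

lemma reflection_cap_subset:
  assumes "a_dir \<Omega> \<nu> < l" "ereal l < lambda1 \<Omega> \<nu>"
  shows "reflection \<nu> l ` cap \<Omega> \<nu> l \<subseteq> \<Omega>"
  using assms unfolding lambda1_def less_Sup_iff by (fastforce dest: less_imp_le)

text \<open>Convexity of the singular nonlinearity: the increment over a step of fixed length grows with the
  base point, and it decreases with the length of the step.\<close>

lemma powr_shift_diff_mono:
  fixes s t w w' \<gamma> :: real
  assumes "\<gamma> > 0" "0 < s" "s \<le> t" "0 \<le> w'" "w' \<le> w"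
  shows "(s + w) powr (-\<gamma>) - s powr (-\<gamma>) \<le> (t + w') powr (-\<gamma>) - t powr (-\<gamma>)"
proof -
  have "(s + w) powr (-\<gamma>) - s powr (-\<gamma>) \<le> (t + w) powr (-\<gamma>) - t powr (-\<gamma>)"
  proof (rule DERIV_nonneg_imp_nondecreasing[OF assms(3)])
    fix x assume x: "s \<le> x" "x \<le> t"
    then have "0 < x" "0 \<le> w" using assms by auto
    then have "((\<lambda>x. (x + w) powr (-\<gamma>) - x powr (-\<gamma>)) has_real_derivative
        \<gamma> * (x powr (-\<gamma> - 1) - (x + w) powr (-\<gamma> - 1))) (at x)"
      by (auto intro!: derivative_eq_intros simp: algebra_simps)
    moreover have "(x + w) powr (-\<gamma> - 1) \<le> x powr (-\<gamma> - 1)"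
      using assms \<open>0 < x\<close> \<open>0 \<le> w\<close> by (intro powr_mono2') auto
    ultimately show "\<exists>y. ((\<lambda>x. (x + w) powr (-\<gamma>) - x powr (-\<gamma>)) has_real_derivative y) (at x) \<and> 0 \<le> y"
      using assms(1) by (intro exI conjI) auto
  qed
  also have "(t + w) powr (-\<gamma>) \<le> (t + w') powr (-\<gamma>)"
    using assms by (intro powr_mono2') auto
  finally show ?thesis by simp
qed

lemma singular_solution_nonneg:
  assumes "singular_solution \<gamma> f \<Omega> u" "open \<Omega>" "x \<in> closure \<Omega>"
  shows "u x \<ge> 0"
  using assms unfolding singular_solution_def
  by (cases "x \<in> \<Omega>") (auto simp: frontier_def interior_open less_imp_le)

lemma singular_solution_C2:
  assumes "singular_solution \<gamma> f \<Omega> u" "open \<Omega>"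
  obtains G H where "C2_on \<Omega> u G H"
    "\<And>x. x \<in> \<Omega> \<Longrightarrow> trace_of (H x) = - (u x powr (-\<gamma>)) - f (u x)"
proof -
  obtain G H where C: "C2_on \<Omega> u G H" "\<And>x. x \<in> \<Omega> \<Longrightarrow> trace_of (H x) = laplacian u x"
    using C2_on_of_Ck_on assms unfolding singular_solution_def by blast
  have "trace_of (H x) = - (u x powr (-\<gamma>)) - f (u x)" if "x \<in> \<Omega>" for x
  proof -
    have "- laplacian u x = 1 / (u x powr \<gamma>) + f (u x)"
      using assms(1) that by (simp add: singular_solution_def)
    then show ?thesis using C(2)[OF that] by (simp add: powr_minus_divide)
  qed
  with C(1) show ?thesis using that by blast
qed

lemma singular_solution_comparison:
  fixes \<Omega> :: "'a::euclidean_space set"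
  assumes \<Omega>: "open \<Omega>" "bounded \<Omega>" and \<gamma>: "\<gamma> > 0" and f: "\<And>s. s > 0 \<Longrightarrow> f s > 0"
    and u: "singular_solution \<gamma> f \<Omega> u" and u0: "singular_solution \<gamma> (\<lambda>_. 0) \<Omega> u0"
    and x: "x \<in> \<Omega>"
  shows "u0 x \<le> u x"
proof -
  obtain G H where C: "C2_on \<Omega> u G H"
    "\<And>x. x \<in> \<Omega> \<Longrightarrow> trace_of (H x) = - (u x powr (-\<gamma>)) - f (u x)"
    using singular_solution_C2[OF u \<Omega>(1)] by blast
  obtain G0 H0 where C0: "C2_on \<Omega> u0 G0 H0"
    "\<And>x. x \<in> \<Omega> \<Longrightarrow> trace_of (H0 x) = - (u0 x powr (-\<gamma>)) - 0"
    using singular_solution_C2[OF u0 \<Omega>(1)] by blast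
  have "u0 x - u x \<le> 0"
  proof (rule strict_subharmonic_maximum_principle[OF \<Omega> C2_on_diff[OF C0(1) C(1)] _ _ _ x])
    show "continuous_on (closure \<Omega>) (\<lambda>x. u0 x - u x)"
      using u u0 by (intro continuous_on_diff) (auto simp: singular_solution_def)
    show "u0 x - u x \<le> 0" if "x \<in> frontier \<Omega>" for x
      using u u0 that by (simp add: singular_solution_def)
    fix x assume x: "x \<in> \<Omega>" "u0 x - u x > 0"
    have pos: "u x > 0" using u x(1) by (simp add: singular_solution_def)
    then have "u0 x powr (-\<gamma>) \<le> u x powr (-\<gamma>)" using x \<gamma> by (intro powr_mono2') auto
    then show "trace_of (\<lambda>h. H0 x h - H x h) > 0"
      using f[OF pos] x(1) by (simp add: trace_of_diff C(2) C0(2))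
  qed
  then show ?thesis by simp
qed

text \<open>On the part of the frontier of the cap in the frontier of \<open>\<Omega>\<close> the left-hand side vanishes, and on
  the hyperplane both sides agree.  Inside the cap, a positive difference would be strictly
  subharmonic.\<close>

lemma singular_solution_le_reflection:
  fixes \<Omega> :: "'a::euclidean_space set"
  assumes \<Omega>: "open \<Omega>" "bounded \<Omega>" and \<gamma>: "\<gamma> > 0" and \<nu>: "norm \<nu> = 1"
    and R: "reflection \<nu> l ` cap \<Omega> \<nu> l \<subseteq> \<Omega>"
    and u0: "singular_solution \<gamma> (\<lambda>_. 0) \<Omega> u0" and x: "x \<in> cap \<Omega> \<nu> l"
  shows "u0 x \<le> u0 (reflection \<nu> l x)"
proof -
  let ?S = "cap \<Omega> \<nu> l" and ?R = "reflection \<nu> l"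
  obtain G H where C: "C2_on \<Omega> u0 G H"
    "\<And>x. x \<in> \<Omega> \<Longrightarrow> trace_of (H x) = - (u0 x powr (-\<gamma>)) - 0"
    using singular_solution_C2[OF u0 \<Omega>(1)] by blast
  have sub: "?S \<subseteq> \<Omega>" by (auto simp: cap_def)
  have cl: "closure ?S \<subseteq> closure \<Omega>" by (rule closure_mono[OF sub])
  have cu: "continuous_on (closure \<Omega>) u0" using u0 by (simp add: singular_solution_def)
  have "u0 x - u0 (?R x) \<le> 0"
  proof (rule strict_subharmonic_maximum_principle[OF open_cap[OF \<Omega>(1)] bounded_subset[OF \<Omega>(2) sub]
        C2_on_diff[OF C2_on_subset[OF C(1) sub] C2_on_reflection[OF C(1) R]] _ _ _ x])
    show "continuous_on (closure ?S) (\<lambda>x. u0 x - u0 (?R x))"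
      by (intro continuous_on_diff continuous_on_subset[OF cu cl]
          continuous_on_compose2[OF cu continuous_on_reflection reflection_closure_cap[OF R]])
    show "u0 x - u0 (?R x) \<le> 0" if fr: "x \<in> frontier ?S" for x
    proof (cases "x \<in> frontier \<Omega>")
      case True
      have "?R x \<in> closure \<Omega>" using reflection_closure_cap[OF R] fr by (auto simp: frontier_def)
      then have "u0 (?R x) \<ge> 0" by (rule singular_solution_nonneg[OF u0 \<Omega>(1)])
      moreover have "u0 x = 0" using u0 True by (simp add: singular_solution_def)
      ultimately show ?thesis by simp
    next
      case False
      then have "x \<bullet> \<nu> = l" using frontier_cap_cases[OF \<Omega>(1) fr] by blast
      then show ?thesis by (simp add: reflection_def)
    qed
    fix x assume x: "x \<in> ?S" "u0 x - u0 (?R x) > 0"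
    have xs: "x \<in> \<Omega>" "?R x \<in> \<Omega>" using x(1) sub R by auto
    then have "u0 (?R x) > 0" using u0 by (simp add: singular_solution_def)
    then have "u0 x powr (-\<gamma>) < u0 (?R x) powr (-\<gamma>)"
      using x(2) \<gamma> by (intro powr_less_mono2_neg) auto
    then show "trace_of (\<lambda>h. H x h - refl_lin \<nu> (H (?R x) (refl_lin \<nu> h))) > 0"
      using xs by (simp add: trace_of_diff trace_of_hessian_reflection[OF C(1) _ \<nu>] C(2))
  qed
  then show ?thesis by simp
qed

text \<open>The left-hand side is \<open>-\<Delta>(w - w \<circ> R)\<close> at \<open>x\<close>.  With \<open>s = u0 x\<close> and \<open>t = u0 xr\<close> both evaluations of
  \<open>f\<close> are compared through the base point \<open>t\<close>: \<open>f (s + w) \<le> f (t + w)\<close> by monotonicity, and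
  \<open>t + w \<le> 2 B\<close> explains the interval of the Lipschitz bound.\<close>

lemma reflection_difference_inequality:
  fixes \<Omega> :: "'a::euclidean_space set"
  assumes \<Omega>: "open \<Omega>" "bounded \<Omega>" and \<gamma>: "\<gamma> > 0" and \<nu>: "norm \<nu> = 1"
    and f: "\<And>s. s > 0 \<Longrightarrow> f s > 0" and mono: "mono_on {0..} f"
    and u: "singular_solution \<gamma> f \<Omega> u" and u0: "singular_solution \<gamma> (\<lambda>_. 0) \<Omega> u0"
    and B: "\<And>x. x \<in> \<Omega> \<Longrightarrow> u x \<le> B" and lip: "L-lipschitz_on {0..2 * B} f"
    and R: "reflection \<nu> l ` cap \<Omega> \<nu> l \<subseteq> \<Omega>" and x: "x \<in> cap \<Omega> \<nu> l"
    and gt: "u (reflection \<nu> l x) - u0 (reflection \<nu> l x) \<le> u x - u0 x"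
  defines "xr \<equiv> reflection \<nu> l x"
  shows "(u x powr (-\<gamma>) + f (u x) - u0 x powr (-\<gamma>)) - (u xr powr (-\<gamma>) + f (u xr) - u0 xr powr (-\<gamma>))
    \<le> L * ((u x - u0 x) - (u xr - u0 xr))"
proof -
  have x\<Omega>: "x \<in> \<Omega>" "xr \<in> \<Omega>" using x R by (auto simp: cap_def xr_def)
  define s t w w' where "s = u0 x" and "t = u0 xr" and "w = u x - u0 x" and "w' = u xr - u0 xr"
  have ux: "u x = s + w" "u xr = t + w'" by (auto simp: s_def t_def w_def w'_def)
  have pos: "0 < s" "0 < t" using u0 x\<Omega> by (auto simp: s_def t_def singular_solution_def)
  have st: "s \<le> t"
    unfolding s_def t_def xr_def by (rule singular_solution_le_reflection[OF \<Omega> \<gamma> \<nu> R u0 x])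
  have w: "0 \<le> w'" "w' \<le> w"
    using singular_solution_comparison[OF \<Omega> \<gamma> f u u0 x\<Omega>(2)] gt by (auto simp: w_def w'_def xr_def)
  have bounds: "s + w \<le> B" "t + w' \<le> B" using B[OF x\<Omega>(1)] B[OF x\<Omega>(2)] ux by auto
  have "f (s + w) \<le> f (t + w)" using pos st w by (intro mono_onD[OF mono]) auto
  also have "\<dots> \<le> f (t + w') + L * (w - w')"
    using lipschitz_onD[OF lip, of "t + w" "t + w'"] pos st w bounds by (auto simp: dist_real_def)
  finally have "f (s + w) - f (t + w') \<le> L * (w - w')" by simp
  moreover have "(s + w) powr (-\<gamma>) - s powr (-\<gamma>) \<le> (t + w') powr (-\<gamma>) - t powr (-\<gamma>)"
    using powr_shift_diff_mono[OF \<gamma>] pos st w by blast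
  ultimately show ?thesis
    unfolding ux by (simp add: s_def[symmetric] t_def[symmetric] algebra_simps)
qed

section \<open>The maximum principle for the reflected difference\<close>

theorem proposition4p4:
  fixes \<Omega> :: "'a::euclidean_space set"
    and f :: "real \<Rightarrow> real"
    and u :: "'a \<Rightarrow> real"
  assumes "bounded_smooth_domain \<Omega>"
    and "locally_lipschitz_on {0..} f"
    and "mono_on {0..} f"
    and "\<And>s. s > 0 \<Longrightarrow> f s > 0"
    and "f 0 \<ge> 0"
  shows "\<exists>\<delta>>0. \<forall>\<gamma> u\<^sub>0. \<gamma> > 0 \<longrightarrow> singular_solution \<gamma> f \<Omega> u \<longrightarrow>
      singular_solution \<gamma> (\<lambda>_. 0) \<Omega> u\<^sub>0 \<longrightarrow>
      (let w = (\<lambda>x. u x - u\<^sub>0 x) in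
       \<forall>\<nu> l \<Omega>'. norm \<nu> = 1 \<longrightarrow> a_dir \<Omega> \<nu> < l \<longrightarrow> ereal l < lambda1 \<Omega> \<nu> \<longrightarrow>
         open \<Omega>' \<longrightarrow> \<Omega>' \<subseteq> cap \<Omega> \<nu> l \<longrightarrow>
         (\<forall>x\<in>frontier \<Omega>'. w x \<le> w (reflection \<nu> l x)) \<longrightarrow>
         measure lebesgue \<Omega>' \<le> \<delta> \<longrightarrow>
         (\<forall>x\<in>\<Omega>'. w x \<le> w (reflection \<nu> l x)))"
proof (cases "continuous_on (closure \<Omega>) u")
  case False
  \<comment> \<open>no solution, so any \<open>\<delta>\<close> will do\<close>
  then have "\<not> singular_solution \<gamma> f \<Omega> u" for \<gamma> by (simp add: singular_solution_def)
  then show ?thesis by (intro exI[of _ 1]) auto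
next
  case True
  have \<Omega>: "open \<Omega>" "bounded \<Omega>" using assms(1) by (auto simp: bounded_smooth_domain_def)
  then have "compact (u ` closure \<Omega>)" using True by (intro compact_continuous_image) auto
  then obtain B where B: "\<And>x. x \<in> closure \<Omega> \<Longrightarrow> \<bar>u x\<bar> \<le> B"
    using compact_imp_bounded[of "u ` closure \<Omega>"] by (auto simp: bounded_iff)
  have uB: "u x \<le> B" if "x \<in> \<Omega>" for x using B[of x] that closure_subset[of \<Omega>] by auto
  have "local_lipschitz {0::real} {0..2 * B} (\<lambda>_. f)"
    by (rule local_lipschitz_subset[OF assms(2)]) auto
  then obtain L0 where L0: "L0-lipschitz_on {0..2 * B} f"
    using local_lipschitz_compact_implies_lipschitz[of "{0::real}" "{0..2 * B}" "\<lambda>_. f"] by auto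
  \<comment> \<open>\<open>L0\<close> may be zero, but \<open>small_volume_maximum_principle\<close> wants a positive constant\<close>
  define L where "L = L0 + 1"
  have L: "L-lipschitz_on {0..2 * B} f" by (rule lipschitz_on_le[OF L0]) (simp add: L_def)
  have "L > 0" using lipschitz_on_nonneg[OF L0] by (simp add: L_def)
  from small_volume_maximum_principle[OF this, where 'a='a] obtain \<delta> where "\<delta> > 0" and \<delta>:
    "\<And>S \<phi> G H. open (S :: 'a set) \<Longrightarrow> bounded S \<Longrightarrow> C2_on S \<phi> G H \<Longrightarrow> continuous_on (closure S) \<phi> \<Longrightarrow>
      \<forall>x\<in>frontier S. \<phi> x \<le> 0 \<Longrightarrow> \<forall>x\<in>S. \<phi> x > 0 \<longrightarrow> - trace_of (H x) \<le> L * \<phi> x \<Longrightarrow>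
      measure lebesgue S \<le> \<delta> \<Longrightarrow> \<forall>x\<in>S. \<phi> x \<le> 0"
    by blast
  show ?thesis
  proof (rule exI[of _ \<delta>], rule conjI[OF \<open>\<delta> > 0\<close>], unfold Let_def, intro allI impI)
    fix \<gamma> u0 \<nu> l \<Omega>'
    assume \<gamma>: "\<gamma> > 0" and u: "singular_solution \<gamma> f \<Omega> u" and u0: "singular_solution \<gamma> (\<lambda>_. 0) \<Omega> u0"
      and \<nu>: "norm \<nu> = 1" and l: "a_dir \<Omega> \<nu> < l" "ereal l < lambda1 \<Omega> \<nu>"
      and \<Omega>': "open \<Omega>'" and sub: "\<Omega>' \<subseteq> cap \<Omega> \<nu> l"
      and bd: "\<forall>x\<in>frontier \<Omega>'. u x - u0 x \<le> u (reflection \<nu> l x) - u0 (reflection \<nu> l x)"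
      and small: "measure lebesgue \<Omega>' \<le> \<delta>"
    let ?R = "reflection \<nu> l"
    have R: "?R ` cap \<Omega> \<nu> l \<subseteq> \<Omega>" by (rule reflection_cap_subset[OF l])
    have R': "?R ` \<Omega>' \<subseteq> \<Omega>" using R sub by blast
    have sub': "\<Omega>' \<subseteq> \<Omega>" using sub by (auto simp: cap_def)
    have clR: "?R ` closure \<Omega>' \<subseteq> closure \<Omega>"
      using reflection_closure_cap[OF R] closure_mono[OF sub] by blast
    obtain G H where C: "C2_on \<Omega> u G H"
      "\<And>x. x \<in> \<Omega> \<Longrightarrow> trace_of (H x) = - (u x powr (-\<gamma>)) - f (u x)"
      using singular_solution_C2[OF u \<Omega>(1)] by blast
    obtain G0 H0 where C0: "C2_on \<Omega> u0 G0 H0"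
      "\<And>x. x \<in> \<Omega> \<Longrightarrow> trace_of (H0 x) = - (u0 x powr (-\<gamma>)) - 0"
      using singular_solution_C2[OF u0 \<Omega>(1)] by blast
    note Cw = C2_on_diff[OF C(1) C0(1)]
    note C\<phi> = C2_on_diff[OF C2_on_subset[OF Cw sub'] C2_on_reflection[OF Cw R']]
    have cw: "continuous_on (closure \<Omega>) (\<lambda>x. u x - u0 x)"
      using u u0 by (intro continuous_on_diff) (auto simp: singular_solution_def)
    have "\<forall>x\<in>\<Omega>'. u x - u0 x - (u (?R x) - u0 (?R x)) \<le> 0"
    proof (rule \<delta>[OF \<Omega>' bounded_subset[OF \<Omega>(2) sub'] C\<phi> _ _ _ small])
      show "continuous_on (closure \<Omega>') (\<lambda>x. u x - u0 x - (u (?R x) - u0 (?R x)))"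
        by (intro continuous_on_diff[OF continuous_on_subset[OF cw closure_mono[OF sub']]
            continuous_on_compose2[OF cw continuous_on_reflection clR]])
      show "\<forall>x\<in>frontier \<Omega>'. u x - u0 x - (u (?R x) - u0 (?R x)) \<le> 0" using bd by simp
      show "\<forall>x\<in>\<Omega>'. u x - u0 x - (u (?R x) - u0 (?R x)) > 0 \<longrightarrow>
        - trace_of (\<lambda>h. H x h - H0 x h - refl_lin \<nu> (H (?R x) (refl_lin \<nu> h) - H0 (?R x) (refl_lin \<nu> h)))
          \<le> L * (u x - u0 x - (u (?R x) - u0 (?R x)))"
      proof (intro ballI impI)
        fix x assume x: "x \<in> \<Omega>'" and pos: "u x - u0 x - (u (?R x) - u0 (?R x)) > 0"
        have xs: "x \<in> \<Omega>" "?R x \<in> \<Omega>" using x sub' R' by auto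
        have "(u x powr (-\<gamma>) + f (u x) - u0 x powr (-\<gamma>))
            - (u (?R x) powr (-\<gamma>) + f (u (?R x)) - u0 (?R x) powr (-\<gamma>))
          \<le> L * (u x - u0 x - (u (?R x) - u0 (?R x)))"
          by (rule reflection_difference_inequality[OF \<Omega> \<gamma> \<nu> assms(4,3) u u0 uB L R])
             (use x sub pos in auto)
        then show "- trace_of (\<lambda>h. H x h - H0 x h - refl_lin \<nu> (H (?R x) (refl_lin \<nu> h) - H0 (?R x) (refl_lin \<nu> h)))
          \<le> L * (u x - u0 x - (u (?R x) - u0 (?R x)))"
          using xs by (simp add: trace_of_diff trace_of_hessian_reflection[OF Cw _ \<nu>] C(2) C0(2))
      qed
    qed
    then show "\<forall>x\<in>\<Omega>'. u x - u0 x \<le> u (?R x) - u0 (?R x)" by simp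
  qed
qed

end
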